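(* (a) The problems $\min_{x,y}{}_{\mathcal K}\{F(x,y)\mid x\in X,\ f(x,y)\in\Phi(x),\ y\in\Gamma(x)\}$ and $\min_{x,y}{}_{\mathcal K}\{F(x,y)\mid x\in X,\ f(x,y)\in\Phi(x)-\mathcal C,\ y\in\Gamma(x)\}$ possess the same feasible set, i.e. $$\{(x,y)\mid x\in X,\ f(x,y)\in\Phi(x),\ y\in\Gamma(x)\}=\{(x,y)\mid x\in X,\ f(x,y)\in\Phi(x)-\mathcal C,\ y\in\Gamma(x)\}.$$ (b) The problems $\min_{x,y}{}_{\mathcal K}\{F(x,y)\mid x\in X,\ f(x,y)\in\Phi_{\mathrm w}(x),\ y\in\Gamma(x)\}$ and $\min_{x,y}{}_{\mathcal K}\{F(x,y)\mid x\in X,\ f(x,y)\in\Phi_{\mathrm w}(x)-\mathcal C,\ y\in\Gamma(x)\}$ possess the same feasible set, i.e. $$\{(x,y)\mid x\in X,\ f(x,y)\in\Phi_{\mathrm w}(x),\ y\in\Gamma(x)\}=\{(x,y)\mid x\in X,\ f(x,y)\in\Phi_{\mathrm w}(x)-\mathcal C,\ y\in\Gamma(x)\}.$$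
   Context: Setting: $F\colon\mathbb R^n\times\mathbb R^m\to\mathbb R^p$ is continuous, $\mathcal K\subset\mathbb R^p$ is a nonempty, closed, convex, pointed cone with nonempty interior, $X\subset\mathbb R^n$ is nonempty and closed, $f\colon\mathbb R^n\times\mathbb R^m\to\mathbb R^q$ is continuous, $\mathcal C\subset\mathbb R^q$ is a nonempty, closed, convex, pointed cone with nonempty interior, and $\Gamma\colon\mathbb R^n\rightrightarrows\mathbb R^m$ is a set-valued mapping (values may be empty) with closed graph. For $x\in\mathbb R^n$ let $f(x,A):=\{f(x,y)\mid y\in A\}$ for $A\subset\mathbb R^m$, and define $\Psi(x):=\{y\in\Gamma(x)\mid (\{f(x,y)\}-\mathcal C\setminus\{0\})\cap f(x,\Gamma(x))=\emptyset\}$ (efficient points), $\Psi_{\mathrm w}(x):=\{y\in\Gamma(x)\mid (\{f(x,y)\}-\operatorname{int}\mathcal C)\cap f(x,\Gamma(x))=\emptyset\}$ (weakly efficient points), $\Phi(x):=f(x,\Psi(x))$, and $\Phi_{\mathrm w}(x):=f(x,\Psi_{\mathrm w}(x))$. Here $A-\mathcal C:=\{a-c\mid a\in A,\ c\in\mathcal C\}$. *)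

theory Defs
  imports "HOL-Analysis.Analysis"
begin

definition minkowski_diff :: "'a::ab_group_add set \<Rightarrow> 'a set \<Rightarrow> 'a set"
  where "minkowski_diff A C = {a - c | a c. a \<in> A \<and> c \<in> C}"

definition pointed :: "'a::real_vector set \<Rightarrow> bool"
  where "pointed C \<longleftrightarrow> C \<inter> uminus ` C = {0}"

text \<open>The library's \<^const>\<open>cone\<close> allows the scalar 0, so a nonempty cone contains 0. For closed
  nonempty sets this agrees with the convention that only admits positive scalars.\<close>

definition ordering_cone :: "'a::euclidean_space set \<Rightarrow> bool"
  where "ordering_cone C \<longleftrightarrow>
    C \<noteq> {} \<and> closed C \<and> convex C \<and> cone C \<and> pointed C \<and> interior C \<noteq> {}"

definition image_at :: "('x \<times> 'y \<Rightarrow> 'z) \<Rightarrow> 'x \<Rightarrow> 'y set \<Rightarrow> 'z set"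
  where "image_at f x A = {f (x, y) | y. y \<in> A}"

definition closed_graph :: "('x::topological_space \<Rightarrow> 'y::topological_space set) \<Rightarrow> bool"
  where "closed_graph \<Gamma> \<longleftrightarrow> closed {(x, y). y \<in> \<Gamma> x}"

definition efficient_points ::
    "'z::euclidean_space set \<Rightarrow> ('x \<times> 'y \<Rightarrow> 'z) \<Rightarrow> ('x \<Rightarrow> 'y set) \<Rightarrow> 'x \<Rightarrow> 'y set"
  where "efficient_points C f \<Gamma> x =
    {y \<in> \<Gamma> x. minkowski_diff {f (x, y)} (C - {0}) \<inter> image_at f x (\<Gamma> x) = {}}"

definition weakly_efficient_points ::
    "'z::euclidean_space set \<Rightarrow> ('x \<times> 'y \<Rightarrow> 'z) \<Rightarrow> ('x \<Rightarrow> 'y set) \<Rightarrow> 'x \<Rightarrow> 'y set"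
  where "weakly_efficient_points C f \<Gamma> x =
    {y \<in> \<Gamma> x. minkowski_diff {f (x, y)} (interior C) \<inter> image_at f x (\<Gamma> x) = {}}"

definition efficient_values ::
    "'z::euclidean_space set \<Rightarrow> ('x \<times> 'y \<Rightarrow> 'z) \<Rightarrow> ('x \<Rightarrow> 'y set) \<Rightarrow> 'x \<Rightarrow> 'z set"
  where "efficient_values C f \<Gamma> x = image_at f x (efficient_points C f \<Gamma> x)"

definition weakly_efficient_values ::
    "'z::euclidean_space set \<Rightarrow> ('x \<times> 'y \<Rightarrow> 'z) \<Rightarrow> ('x \<Rightarrow> 'y set) \<Rightarrow> 'x \<Rightarrow> 'z set"
  where "weakly_efficient_values C f \<Gamma> x = image_at f x (weakly_efficient_points C f \<Gamma> x)"

end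

theory Submission
  imports Defs
begin

text \<open>If an attainable value \<open>f (x, y)\<close> lies below an efficient value in the order of \<open>C\<close>, the two
  coincide; if it lies below a weakly efficient value, it is itself weakly efficient, because
  \<open>C + interior C \<subseteq> interior C\<close>. The converse inclusions hold because \<open>0 \<in> C\<close>.\<close>

lemma subset_minkowski_diff:
  assumes "0 \<in> C"
  shows "A \<subseteq> minkowski_diff A C"
  using assms unfolding minkowski_diff_def by force

text \<open>A convex cone is closed under addition, so translating \<open>interior C\<close> by
  \<open>c\<close> gives an open subset of \<open>C\<close>; the interior contains every such
  subset.\<close>

lemma add_mem_interior_convex_cone:
  fixes C :: "'a::real_normed_vector set"
  assumes "convex C" "cone C" "c \<in> C" "d \<in> interior C"
  shows "c + d \<in> interior C"
proof -
  have "(+) c ` interior C \<subseteq> C"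
    using assms convex_cone[of C] interior_subset[of C] by blast
  then have "(+) c ` interior C \<subseteq> interior C"
    by (intro interior_maximal open_translation open_interior)
  then show ?thesis
    using assms(4) by blast
qed

text \<open>If \<open>f (x, y)\<close> differed from the efficient value above it, it would be an
  attained value that dominates that value, contradicting efficiency.\<close>

lemma efficient_value_if_below:
  assumes "y \<in> \<Gamma> x" "f (x, y) \<in> minkowski_diff (efficient_values C f \<Gamma> x) C"
  shows "f (x, y) \<in> efficient_values C f \<Gamma> x"
proof -
  obtain y' c where y': "y' \<in> efficient_points C f \<Gamma> x" and "c \<in> C"
    and eq: "f (x, y) = f (x, y') - c"
    using assms(2) by (auto simp: minkowski_diff_def efficient_values_def image_at_def)
  have "c = 0"
  proof (rule ccontr)
    assume "c \<noteq> 0"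
    with \<open>c \<in> C\<close> eq have "f (x, y) \<in> minkowski_diff {f (x, y')} (C - {0})"
      by (auto simp: minkowski_diff_def)
    moreover have "f (x, y) \<in> image_at f x (\<Gamma> x)"
      using assms(1) by (auto simp: image_at_def)
    ultimately show False
      using y' by (auto simp: efficient_points_def)
  qed
  \<comment> \<open>Since \<open>c = 0\<close>, the efficient point \<open>y'\<close> serves as the
    preimage of \<open>f (x, y)\<close>; efficiency of \<open>y\<close> itself is not
    derived.\<close>
  with eq y' show ?thesis
    by (auto simp: efficient_values_def image_at_def)
qed

text \<open>Here \<open>f (x, y)\<close> may differ from the value above it, so \<open>y\<close>
  itself has to be shown weakly efficient.\<close>

lemma weakly_efficient_value_if_below:
  assumes "convex C" "cone C"
    and "y \<in> \<Gamma> x" "f (x, y) \<in> minkowski_diff (weakly_efficient_values C f \<Gamma> x) C"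
  shows "f (x, y) \<in> weakly_efficient_values C f \<Gamma> x"
proof -
  obtain y' c where y': "y' \<in> weakly_efficient_points C f \<Gamma> x" and "c \<in> C"
    and eq: "f (x, y) = f (x, y') - c"
    using assms(4) by (auto simp: minkowski_diff_def weakly_efficient_values_def image_at_def)
  \<comment> \<open>Whatever strictly dominates \<open>f (x, y)\<close> also strictly dominates
    \<open>f (x, y')\<close>: the two descents \<open>c\<close> and \<open>d\<close> add up to an
    interior direction.\<close>
  have "minkowski_diff {f (x, y)} (interior C) \<subseteq> minkowski_diff {f (x, y')} (interior C)"
  proof
    fix v
    assume "v \<in> minkowski_diff {f (x, y)} (interior C)"
    then obtain d where "d \<in> interior C" and "v = f (x, y') - (c + d)"
      using eq by (auto simp: minkowski_diff_def algebra_simps)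
    then show "v \<in> minkowski_diff {f (x, y')} (interior C)"
      using add_mem_interior_convex_cone[OF assms(1,2) \<open>c \<in> C\<close>]
      unfolding minkowski_diff_def by blast
  qed
  \<comment> \<open>Disjointness from the attained values passes to the smaller set.\<close>
  with y' assms(3) have "y \<in> weakly_efficient_points C f \<Gamma> x"
    unfolding weakly_efficient_points_def by blast
  then show ?thesis
    by (auto simp: weakly_efficient_values_def image_at_def)
qed

theorem corollary3p4:
  fixes F :: "(real^'n) \<times> (real^'m) \<Rightarrow> real^'p"
    and K :: "(real^'p) set"
    and X :: "(real^'n) set"
    and f :: "(real^'n) \<times> (real^'m) \<Rightarrow> real^'q"
    and C :: "(real^'q) set"
    and \<Gamma> :: "real^'n \<Rightarrow> (real^'m) set"
  assumes "continuous_on UNIV F" and "ordering_cone K"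
    and "X \<noteq> {}" and "closed X"
    and "continuous_on UNIV f" and "ordering_cone C"
    and "closed_graph \<Gamma>"
  shows "({(x, y). x \<in> X \<and> f (x, y) \<in> efficient_values C f \<Gamma> x \<and> y \<in> \<Gamma> x} =
          {(x, y). x \<in> X \<and> f (x, y) \<in> minkowski_diff (efficient_values C f \<Gamma> x) C \<and> y \<in> \<Gamma> x}) \<and>
         ({(x, y). x \<in> X \<and> f (x, y) \<in> weakly_efficient_values C f \<Gamma> x \<and> y \<in> \<Gamma> x} =
          {(x, y). x \<in> X \<and> f (x, y) \<in> minkowski_diff (weakly_efficient_values C f \<Gamma> x) C \<and> y \<in> \<Gamma> x})"
proof -
  have C: "convex C" "cone C" "0 \<in> C"
    using \<open>ordering_cone C\<close> cone_contains_0[of C] by (auto simp: ordering_cone_def)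
  show ?thesis
    using subset_minkowski_diff[OF C(3)] efficient_value_if_below[of _ \<Gamma> _ f C]
      weakly_efficient_value_if_below[OF C(1,2), of _ \<Gamma> _ f]
    by blast
qed

end
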